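(* There exists $n_0$ such that the following holds. Let $n \ge n_0$ and $t \ge 0$ be integers such that $3 \mid n+t$ and $t \leq n/1000$, and put $k = \lceil (t+1)/2 \rceil$. If $G$ is an $n$-vertex graph such that $G \ast K_t$ does not have a $K_3$-factor, then $$e(G) \leq \binom{n}{2} - \binom{k}{2} - \begin{cases} k(n-k), & \text{if } t \text{ is odd}, \\ k(n-k-1), & \text{if } t \text{ is even}. \end{cases}$$ This bound on $e(G)$ is sharp, i.e. for all such $n$ and $t$ there is an $n$-vertex graph $G$ for which $G \ast K_t$ has no $K_3$-factor and equality holds.
   Context: Graphs are finite and simple, and $e(G)$ denotes the number of edges of $G$. For a graph $G$ and an integer $t \ge 0$, the join $G \ast K_t$ is the graph obtained from $G$ by adding $t$ new vertices and all edges incident to at least one of the new vertices. A $K_3$-factor of a graph is a collection of vertex-disjoint triangles (copies of $K_3$) covering every vertex. *)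

theory Defs
  imports Complex_Main
begin

type_synonym 'a ugraph = "'a set \<times> 'a set set"

abbreviation verts :: "'a ugraph \<Rightarrow> 'a set" where
  "verts G \<equiv> fst G"

abbreviation edges :: "'a ugraph \<Rightarrow> 'a set set" where
  "edges G \<equiv> snd G"

definition simple_graph :: "'a ugraph \<Rightarrow> bool" where
  "simple_graph G \<longleftrightarrow> finite (verts G) \<and> (\<forall>e\<in>edges G. e \<subseteq> verts G \<and> card e = 2)"

definition num_edges :: "'a ugraph \<Rightarrow> nat" where
  "num_edges G = card (edges G)"

text \<open>The old vertices are tagged by \<open>Inl\<close>; the new ones are \<open>Inr 0, \<dots>, Inr (t - 1)\<close>.\<close>

definition join_complete :: "'a ugraph \<Rightarrow> nat \<Rightarrow> ('a + nat) ugraph" where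
  "join_complete G t =
     (let W = verts G <+> {..<t} in
       (W, (\<lambda>e. Inl ` e) ` edges G \<union> {{x, y} | x y. x \<in> Inr ` {..<t} \<and> y \<in> W \<and> x \<noteq> y}))"

text \<open>A copy of \<open>K\<^sub>3\<close> is determined by its vertex set, so triangles are represented by vertex sets.\<close>

definition triangle :: "'a ugraph \<Rightarrow> 'a set \<Rightarrow> bool" where
  "triangle G T \<longleftrightarrow> T \<subseteq> verts G \<and> card T = 3 \<and> (\<forall>x\<in>T. \<forall>y\<in>T. x \<noteq> y \<longrightarrow> {x, y} \<in> edges G)"

definition has_K3_factor :: "'a ugraph \<Rightarrow> bool" where
  "has_K3_factor G \<longleftrightarrow>
     (\<exists>F. (\<forall>T\<in>F. triangle G T) \<and> pairwise disjnt F \<and> \<Union>F = verts G)"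

end

theory Submission
  imports Defs
begin

text \<open>The bound equals \<open>n - k choose 2\<close>, plus \<open>k\<close> if \<open>t\<close> is even. So a graph \<open>G\<close> with more edges than
  that misses fewer than \<open>k n\<close> pairs, and all but \<open>20 k\<close> of its vertices have fewer than \<open>n / 10\<close>
  non-neighbours. Let \<open>A\<close> be the set of vertices of degree at most \<open>n / 8\<close>. A vertex of \<open>A\<close> can be
  covered by a triangle with two new vertices, and by one with a single new vertex if it lies on a
  chosen edge of \<open>G\<close>; since many edges meet every set of at least \<open>k\<close> vertices, a matching of
  \<open>2 |A| - t\<close> edges meeting \<open>A\<close> (or, when \<open>|A| = k\<close>, an edge inside \<open>A\<close> or a triangle) makes \<open>t\<close>
  new vertices suffice. The other exceptional vertices are covered greedily, because a large
  neighbourhood spans an edge avoiding everything used before. In what remains every vertex has few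
  non-neighbours, and an exchange argument gives a triangle factor.

  For sharpness, \<open>k\<close> independent vertices with at most one neighbour, the same for all, need \<open>2 k\<close>
  distinct vertices to complete their triangles, but only \<open>2 k - 1\<close> are available.\<close>

section \<open>Cliques, and triangle factors when non-neighbours are few\<close>

definition clique :: "'a set set \<Rightarrow> 'a set \<Rightarrow> bool" where
  "clique E C \<longleftrightarrow> (\<forall>x\<in>C. \<forall>y\<in>C. x \<noteq> y \<longrightarrow> {x, y} \<in> E)"

lemma triangle_iff_clique: "triangle G T \<longleftrightarrow> T \<subseteq> verts G \<and> card T = 3 \<and> clique (edges G) T"
  by (simp add: triangle_def clique_def)

lemma pairwise_disjnt_insertI:
  assumes "pairwise disjnt P" "T \<inter> \<Union>P = {}"
  shows "pairwise disjnt (insert T P)"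
proof -
  have "disjnt T S" "disjnt S T" if "S \<in> P" for S
    using assms(2) that unfolding disjnt_def by blast+
  then show ?thesis using assms(1) by (simp add: pairwise_insert)
qed

lemma partition_into_triples:
  assumes "finite W" "3 dvd card W"
  shows "\<exists>P. (\<forall>T\<in>P. card T = 3) \<and> pairwise disjnt P \<and> \<Union>P = W"
proof -
  obtain m where "card W = 3 * m" using assms(2) by blast
  then show ?thesis using assms(1)
  proof (induction m arbitrary: W)
    case 0
    then have "W = {}" by simp
    then show ?case by (metis Union_empty empty_iff pairwise_empty)
  next
    case (Suc m)
    have "3 \<le> card W" using Suc.prems by simp
    then obtain T where T: "T \<subseteq> W" "card T = 3"
      using obtain_subset_with_card_n by metis
    then have "card (W - T) = 3 * m" using Suc.prems by (simp add: card_Diff_subset finite_subset)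
    then obtain P where P: "\<forall>T\<in>P. card T = 3" "pairwise disjnt P" "\<Union>P = W - T"
      using Suc.IH[of "W - T"] Suc.prems(2) by blast
    have "pairwise disjnt (insert T P)"
      using P(2,3) by (intro pairwise_disjnt_insertI) auto
    moreover have "\<forall>T'\<in>insert T P. card T' = 3" "\<Union>(insert T P) = W" using P T by auto
    ultimately show ?case by blast
  qed
qed

text \<open>Take a partition into triples whose set of non-adjacent pairs is smallest. A triple with a
  non-adjacent pair \<open>x, y\<close> can be improved by exchanging \<open>x\<close> with a suitable vertex of another triple.\<close>

lemma clique_factor_of_few_nonneighbours:
  assumes fin: "finite W" and dvd: "3 dvd card W"
    and deg: "\<And>v. v \<in> W \<Longrightarrow> card {w\<in>W. w \<noteq> v \<and> {v, w} \<notin> E} \<le> D"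
    and big: "5 * D + 3 < card W"
  shows "\<exists>P. (\<forall>T\<in>P. card T = 3 \<and> clique E T) \<and> pairwise disjnt P \<and> \<Union>P = W"
proof -
  define part where "part P \<longleftrightarrow> (\<forall>T\<in>P. card T = 3) \<and> pairwise disjnt P \<and> \<Union>P = W" for P
  define bad where "bad P = {(u, v). \<exists>T\<in>P. u \<in> T \<and> v \<in> T \<and> u \<noteq> v \<and> {u, v} \<notin> E}" for P
  obtain P where P: "part P" and min: "\<And>P'. part P' \<Longrightarrow> card (bad P) \<le> card (bad P')"
    using partition_into_triples[OF fin dvd] ex_has_least_nat[of part _ "\<lambda>P. card (bad P)"]
    unfolding part_def by metis
  have P3: "\<And>T. T \<in> P \<Longrightarrow> card T = 3" and Pdis: "pairwise disjnt P" and PW: "\<Union>P = W"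
    using P by (auto simp: part_def)
  have uniq: "T = T'" if "T \<in> P" "T' \<in> P" "u \<in> T" "u \<in> T'" for T T' u
    using Pdis that by (auto simp: pairwise_def disjnt_def)
  have finT: "finite T" if "T \<in> P" for T using P3[OF that] by (metis card.infinite zero_neq_numeral)
  have finbad: "finite (bad P)"
  proof (rule finite_subset)
    show "bad P \<subseteq> W \<times> W" using PW by (auto simp: bad_def)
  qed (use fin in simp)
  have "clique E T1" if T1: "T1 \<in> P" for T1
  proof (rule ccontr)
    assume "\<not> clique E T1"
    then obtain x y where xy: "x \<in> T1" "y \<in> T1" "x \<noteq> y" "{x, y} \<notin> E" by (auto simp: clique_def)
    have "card (T1 - {x, y}) = 1" using xy P3[OF T1] finT[OF T1] by (simp add: card_Diff_subset)
    then obtain z where "T1 - {x, y} = {z}" by (auto simp: card_1_singleton_iff)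
    then have T1e: "T1 = {x, y, z}" "z \<noteq> x" "z \<noteq> y" using xy by auto
    have xW: "x \<in> W" "y \<in> W" "z \<in> W" using PW T1 T1e by auto
    have "\<forall>u\<in>W. \<exists>T. T \<in> P \<and> u \<in> T" using PW by blast
    then obtain tr where tr: "\<And>u. u \<in> W \<Longrightarrow> tr u \<in> P \<and> u \<in> tr u" by metis
    define N where "N v = {w\<in>W. w \<noteq> v \<and> {v, w} \<notin> E}" for v
    have Nfin: "finite (N v)" for v using fin by (simp add: N_def)
    have Nc: "card (N v) \<le> D" if "v \<in> W" for v using deg that by (simp add: N_def)
    \<comment> \<open>\<open>X\<close> collects the vertices unfit for the exchange with
      \<open>x\<close>: those of \<open>T1\<close>, the non-neighbours of \<open>y\<close> or
      \<open>z\<close>, and every vertex whose triple contains a non-neighbour of \<open>x\<close>.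
      Its size is at most \<open>3 + D + D + 3 * D\<close>, which is where the hypothesis
      \<open>big\<close> comes from.\<close>
    define X where "X = T1 \<union> N y \<union> N z \<union> (\<Union>u\<in>N x. tr u)"
    have "card (\<Union>u\<in>N x. tr u) \<le> (\<Sum>u\<in>N x. card (tr u))"
      using Nfin by (rule card_UN_le)
    also have "\<dots> = (\<Sum>u\<in>N x. 3)"
      by (rule sum.cong) (use tr P3 in \<open>auto simp: N_def\<close>)
    finally have "card (\<Union>u\<in>N x. tr u) \<le> 3 * D" using Nc[OF xW(1)] by simp
    moreover have "card X \<le> card T1 + card (N y) + card (N z) + card (\<Union>u\<in>N x. tr u)"
      unfolding X_def by (intro order.trans[OF card_Un_le] add_right_mono order.refl)
    ultimately have "card X < card W"
      using P3[OF T1] Nc[OF xW(2)] Nc[OF xW(3)] big by linarith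
    moreover have "finite X" using finT[OF T1] Nfin tr finT by (auto simp: X_def N_def)
    ultimately obtain w where w: "w \<in> W" "w \<notin> X"
      by (metis card_mono linorder_not_less subsetI)
    define T2 where "T2 = tr w"
    have T2: "T2 \<in> P" "w \<in> T2" using tr w by (auto simp: T2_def)
    have ne: "T2 \<noteq> T1" using T2 w by (auto simp: X_def)
    then have dis: "T1 \<inter> T2 = {}" using uniq T1 T2 by blast
    have wy: "{w, y} \<in> E" "{w, z} \<in> E"
      using w T1e by (auto simp: X_def N_def insert_commute)
    have xT2: "{x, u} \<in> E" if "u \<in> T2" for u
    proof (rule ccontr)
      assume "{x, u} \<notin> E"
      moreover have "u \<in> W" "u \<noteq> x" using that T2 PW dis T1e by auto
      ultimately have "u \<in> N x" by (simp add: N_def)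
      moreover have "tr u = T2" using uniq tr \<open>u \<in> W\<close> that T2 by blast
      ultimately show False using w T2 by (auto simp: X_def)
    qed
    define S1 where "S1 = insert w (T1 - {x})"
    define S2 where "S2 = insert x (T2 - {w})"
    define P' where "P' = insert S1 (insert S2 (P - {T1, T2}))"
    have c: "card S1 = 3" "card S2 = 3"
      using P3[OF T1] P3[OF T2(1)] finT[OF T1] finT[OF T2(1)] xy T2 dis
      by (auto simp: S1_def S2_def card_insert_if)
    have S12: "S1 \<inter> S2 = {}" "S1 \<union> S2 = T1 \<union> T2" using dis xy(1) T2(2) by (auto simp: S1_def S2_def)
    have oth: "disjnt T S1" "disjnt T S2" if "T \<in> P - {T1, T2}" for T
    proof -
      have "T \<inter> T1 = {}" "T \<inter> T2 = {}" using that uniq T1 T2 by blast+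
      then show "disjnt T S1" "disjnt T S2" using S12(2) by (auto simp: disjnt_def)
    qed
    have "pairwise disjnt P'"
      unfolding P'_def
    proof (intro pairwise_disjnt_insertI)
      show "pairwise disjnt (P - {T1, T2})" using Pdis by (rule pairwise_subset) auto
      show "S2 \<inter> \<Union>(P - {T1, T2}) = {}" using oth(2) unfolding disjnt_def by blast
      show "S1 \<inter> \<Union>(insert S2 (P - {T1, T2})) = {}"
        using oth(1) S12(1) unfolding disjnt_def by blast
    qed
    moreover have "\<Union>P' = W"
    proof -
      have "\<Union>P' = (S1 \<union> S2) \<union> \<Union>(P - {T1, T2})" by (auto simp: P'_def)
      also have "\<dots> = \<Union>P" unfolding S12(2) using T1 T2 by auto
      finally show ?thesis using PW by simp
    qed
    ultimately have "part P'" using c P3 by (auto simp: part_def P'_def)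
    \<comment> \<open>In the new triples every pair containing \<open>w\<close> or \<open>x\<close>
      is an edge, and every other pair was already together in \<open>T1\<close> or
      \<open>T2\<close>. So no bad pair arises, while \<open>(x, y)\<close> is separated.\<close>
    moreover have "bad P' \<subset> bad P"
    proof
      show "bad P' \<subseteq> bad P"
      proof
        fix p assume "p \<in> bad P'"
        then obtain u v T where p: "p = (u, v)" "T \<in> P'" "u \<in> T" "v \<in> T" "u \<noteq> v" "{u, v} \<notin> E"
          by (auto simp: bad_def)
        have "\<exists>T\<in>P. u \<in> T \<and> v \<in> T"
        proof -
          consider "T = S1" | "T = S2" | "T \<in> P" using p(2) by (auto simp: P'_def)
          then show ?thesis
          proof cases
            case 1
            then have "u \<noteq> w" "v \<noteq> w" using p wy T1e by (auto simp: S1_def insert_commute)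
            then show ?thesis using p T1 1 by (auto simp: S1_def)
          next
            case 2
            then have "u \<noteq> x" "v \<noteq> x" using p xT2 by (auto simp: S2_def insert_commute)
            then show ?thesis using p T2 2 by (auto simp: S2_def)
          qed (use p in auto)
        qed
        then show "p \<in> bad P" using p by (auto simp: bad_def)
      qed
      have "(x, y) \<in> bad P" using xy T1 by (auto simp: bad_def)
      moreover have "(x, y) \<notin> bad P'"
      proof
        assume "(x, y) \<in> bad P'"
        then obtain T where T: "T \<in> P'" "x \<in> T" "y \<in> T" by (auto simp: bad_def)
        have "x \<notin> S1" "y \<notin> S2" using xy T2 dis w by (auto simp: S1_def S2_def X_def)
        then have "T \<in> P - {T1, T2}" using T by (auto simp: P'_def)
        then show False using uniq T1 T xy by blast
      qed
      ultimately show "bad P' \<noteq> bad P" by blast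
    qed
    ultimately show False using min psubset_card_mono[OF finbad] by (metis linorder_not_less)
  qed
  then show ?thesis using P3 Pdis PW by blast
qed

section \<open>Greedy choice of disjoint triples and edges\<close>

text \<open>The elements of \<open>S\<close> are treated one by one, skipping those already covered.
  At each moment there are at most \<open>card F0 + card S\<close> triples, and their union is the
  set \<open>U\<close> to be avoided, hence the factor 3 in the last hypothesis.\<close>

lemma greedy_disjoint_cover:
  assumes "finite S" "finite F0" "pairwise disjnt F0" "\<And>T. T \<in> F0 \<Longrightarrow> card T = 3 \<and> Q T"
    and "\<And>v U. v \<in> S \<Longrightarrow> finite U \<Longrightarrow> card U \<le> 3 * (card F0 + card S) \<Longrightarrow> v \<notin> U
           \<Longrightarrow> \<exists>T. v \<in> T \<and> T \<inter> U = {} \<and> card T = 3 \<and> Q T"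
  shows "\<exists>F. F0 \<subseteq> F \<and> finite F \<and> card F \<le> card F0 + card S \<and> pairwise disjnt F
           \<and> (\<forall>T\<in>F. card T = 3 \<and> Q T) \<and> S \<subseteq> \<Union>F"
  using assms(1,5)
proof (induction S rule: finite_induct)
  case empty
  have "\<forall>T\<in>F0. card T = 3 \<and> Q T" using assms(4) by blast
  then show ?case using assms(2,3) by (intro exI[of _ F0]) simp
next
  case (insert v S)
  have "\<exists>F. F0 \<subseteq> F \<and> finite F \<and> card F \<le> card F0 + card S \<and> pairwise disjnt F
           \<and> (\<forall>T\<in>F. card T = 3 \<and> Q T) \<and> S \<subseteq> \<Union>F"
    by (rule insert.IH, rule insert.prems) (use insert.hyps in auto)
  then obtain F where F: "F0 \<subseteq> F" "finite F" "card F \<le> card F0 + card S" "pairwise disjnt F"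
    "\<forall>T\<in>F. card T = 3 \<and> Q T" "S \<subseteq> \<Union>F" by blast
  show ?case
  proof (cases "v \<in> \<Union>F")
    case True
    then show ?thesis using F insert.hyps by (intro exI[of _ F]) auto
  next
    case False
    have "finite T" if "T \<in> F" for T using F(5) that by (metis card.infinite zero_neq_numeral)
    then have "finite (\<Union>F)" using F(2) by blast
    moreover have "card (\<Union>F) \<le> 3 * card F"
      using card_Union_le_sum_card[of F] F(5) by simp
    ultimately obtain T where T: "v \<in> T" "T \<inter> \<Union>F = {}" "card T = 3" "Q T"
      using insert.prems[of v "\<Union>F"] False F(3) insert.hyps by auto
    have "pairwise disjnt (Set.insert T F)"
      using F(4) T(2) by (rule pairwise_disjnt_insertI)
    moreover have "card (Set.insert T F) \<le> card F0 + card (Set.insert v S)"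
      using F(2,3) insert.hyps by (simp add: card_insert_if)
    ultimately show ?thesis using F T by (intro exI[of _ "Set.insert T F"]) auto
  qed
qed

text \<open>Each chosen set meets at most \<open>L\<close> members of \<open>X\<close>, so
  \<open>s\<close> disjoint sets together meet at most \<open>s * L\<close> members and leave one
  that is disjoint from all of them. Nonemptiness ensures that this member is new, since otherwise
  it would meet itself.\<close>

lemma disjoint_edges_of_bounded_intersections:
  assumes "finite X" "\<And>e. e \<in> X \<Longrightarrow> e \<noteq> {}"
    and "\<And>e. e \<in> X \<Longrightarrow> card {f\<in>X. f \<inter> e \<noteq> {}} \<le> L" and "s * L < card X"
  shows "\<exists>M\<subseteq>X. pairwise disjnt M \<and> card M = Suc s"
  using assms(4)
proof (induction s)
  case 0
  then obtain e where "e \<in> X" by fastforce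
  then show ?case by (intro exI[of _ "{e}"]) auto
next
  case (Suc s)
  then obtain M where M: "M \<subseteq> X" "pairwise disjnt M" "card M = Suc s" by auto
  have fM: "finite M" using M(1) assms(1) finite_subset by blast
  have "card (\<Union>e\<in>M. {f\<in>X. f \<inter> e \<noteq> {}}) \<le> (\<Sum>e\<in>M. card {f\<in>X. f \<inter> e \<noteq> {}})"
    using fM by (rule card_UN_le)
  also have "\<dots> \<le> (\<Sum>e\<in>M. L)" using M(1) assms(3) by (intro sum_mono) auto
  also have "\<dots> < card X" using Suc.prems M(3) by simp
  finally have "card (\<Union>e\<in>M. {f\<in>X. f \<inter> e \<noteq> {}}) < card X" .
  moreover have "finite (\<Union>e\<in>M. {f\<in>X. f \<inter> e \<noteq> {}})" using fM assms(1) by simp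
  ultimately have "\<not> X \<subseteq> (\<Union>e\<in>M. {f\<in>X. f \<inter> e \<noteq> {}})" using card_mono leD by blast
  then obtain f where f: "f \<in> X" "f \<notin> (\<Union>e\<in>M. {f\<in>X. f \<inter> e \<noteq> {}})" by blast
  then have d: "f \<inter> e = {}" if "e \<in> M" for e using that by auto
  then have "f \<notin> M" using assms(2)[OF f(1)] by blast
  then have "card (insert f M) = Suc (Suc s)" using fM M(3) by simp
  moreover have "pairwise disjnt (insert f M)"
    using M(2) d by (intro pairwise_disjnt_insertI) auto
  moreover have "insert f M \<subseteq> X" using M(1) f(1) by blast
  ultimately show ?case by blast
qed

section \<open>Counting edges and non-edges of a finite graph\<close>

locale fin_graph =
  fixes V :: "'a set" and E :: "'a set set"
  assumes finite_V: "finite V"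
    and edge: "e \<in> E \<Longrightarrow> e \<subseteq> V \<and> card e = 2"
begin

definition nbrs :: "'a \<Rightarrow> 'a set" where
  "nbrs v = {w\<in>V. {v, w} \<in> E}"

definition nonnbrs :: "'a \<Rightarrow> 'a set" where
  "nonnbrs v = {w\<in>V. w \<noteq> v \<and> {v, w} \<notin> E}"

definition nonedges :: "'a set set" where
  "nonedges = {e. e \<subseteq> V \<and> card e = 2 \<and> e \<notin> E}"

definition touching :: "'a set \<Rightarrow> 'a set set" where
  "touching A = {e\<in>E. e \<inter> A \<noteq> {}}"

lemma finite_E: "finite E"
  using finite_subset[of E "Pow V"] finite_V edge by auto

lemma finite_touching: "finite (touching A)"
  using finite_E by (simp add: touching_def)

lemma no_loop: "{v, v} \<notin> E"
  using edge[of "{v, v}"] by auto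

lemma edge_doubleton:
  assumes "e \<in> E" "x \<in> e"
  obtains y where "e = {x, y}" "x \<noteq> y" "y \<in> V"
  using edge[OF assms(1)] assms(2) by (auto simp: card_2_iff doubleton_eq_iff)

lemma card_nbrs_nonnbrs:
  assumes "v \<in> V"
  shows "card (nbrs v) + card (nonnbrs v) + 1 = card V"
proof -
  have "V = insert v (nbrs v \<union> nonnbrs v)" using assms by (auto simp: nbrs_def nonnbrs_def)
  moreover have "v \<notin> nbrs v \<union> nonnbrs v" using no_loop by (auto simp: nbrs_def nonnbrs_def)
  moreover have "nbrs v \<inter> nonnbrs v = {}" by (auto simp: nbrs_def nonnbrs_def)
  moreover have "finite (nbrs v)" "finite (nonnbrs v)" using finite_V by (auto simp: nbrs_def nonnbrs_def)
  ultimately show ?thesis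
    by (metis Suc_eq_plus1 card_Un_disjoint card_insert_disjoint finite_UnI)
qed

lemma card_nonedges: "card nonedges + card E = card V choose 2"
proof -
  have "nonedges \<union> E = {e. e \<subseteq> V \<and> card e = 2}" "nonedges \<inter> E = {}"
    using edge by (auto simp: nonedges_def)
  moreover have "finite nonedges"
    using finite_subset[of nonedges "Pow V"] finite_V by (auto simp: nonedges_def)
  ultimately show ?thesis
    using card_Un_disjoint[of nonedges E] finite_E n_subsets[OF finite_V, of 2] by simp
qed

text \<open>Double counting of the pairs consisting of a vertex of \<open>B\<close> and a non-edge
  containing it: a non-edge has at most two ends in \<open>B\<close>.\<close>

lemma sum_card_nonnbrs_le:
  assumes "B \<subseteq> V"
  shows "(\<Sum>v\<in>B. card (nonnbrs v)) \<le> 2 * card nonedges"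
proof -
  have fB: "finite B" using assms finite_V finite_subset by blast
  have fN: "finite nonedges"
    using finite_subset[of nonedges "Pow V"] finite_V by (auto simp: nonedges_def)
  have "card (nonnbrs v) \<le> card {e\<in>nonedges. v \<in> e}" if "v \<in> B" for v
  proof (rule card_inj_on_le)
    show "inj_on (\<lambda>w. {v, w}) (nonnbrs v)" by (auto simp: inj_on_def doubleton_eq_iff)
    show "(\<lambda>w. {v, w}) ` nonnbrs v \<subseteq> {e\<in>nonedges. v \<in> e}"
      using that assms by (auto simp: nonnbrs_def nonedges_def)
  qed (use fN in simp)
  then have "(\<Sum>v\<in>B. card (nonnbrs v)) \<le> (\<Sum>v\<in>B. card {e\<in>nonedges. v \<in> e})"
    by (rule sum_mono)
  also have "\<dots> = (\<Sum>v\<in>B. \<Sum>e\<in>nonedges. if v \<in> e then 1 else 0)"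
    using fN by (simp add: sum.If_cases Int_def)
  also have "\<dots> = (\<Sum>e\<in>nonedges. \<Sum>v\<in>B. if v \<in> e then 1 else 0)" by (rule sum.swap)
  also have "\<dots> = (\<Sum>e\<in>nonedges. card (B \<inter> e))"
    using fB by (simp add: sum.If_cases)
  also have "\<dots> \<le> (\<Sum>e\<in>nonedges. 2)"
  proof (rule sum_mono)
    fix e assume "e \<in> nonedges"
    then have "card e = 2" "finite e" by (auto simp: nonedges_def card_ge_0_finite)
    then show "card (B \<inter> e) \<le> 2" using card_mono[of e "B \<inter> e"] by simp
  qed
  finally show ?thesis by simp
qed

text \<open>The edges missing \<open>A\<close> and the pairs inside the independent set
  \<open>S\<close> are distinct pairs within \<open>V - A\<close>. With \<open>S\<close> empty this
  bounds \<open>touching A\<close> from below; with \<open>A\<close> empty it shows that a large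
  enough set spans an edge.\<close>

lemma card_E_le:
  assumes "A \<subseteq> V" "S \<subseteq> V - A" "\<And>x y. x \<in> S \<Longrightarrow> y \<in> S \<Longrightarrow> {x, y} \<notin> E"
  shows "card E + (card S choose 2) \<le> card (touching A) + (card V - card A choose 2)"
proof -
  have fin: "finite S" "finite A" using assms(1,2) finite_V by (auto intro: finite_subset)
  let ?S = "{e. e \<subseteq> S \<and> card e = 2}"
  have cS: "card ?S = card S choose 2" "finite ?S"
    using n_subsets[OF fin(1)] fin by auto
  have disj: "(E - touching A) \<inter> ?S = {}"
    using assms(3) by (fastforce simp: card_2_iff)
  have "(E - touching A) \<union> ?S \<subseteq> {e. e \<subseteq> V - A \<and> card e = 2}"
    using edge assms(2) by (fastforce simp: touching_def)
  then have "card ((E - touching A) \<union> ?S) \<le> card {e. e \<subseteq> V - A \<and> card e = 2}"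
    using finite_V by (intro card_mono) auto
  also have "\<dots> = card V - card A choose 2"
    using finite_V fin assms(1) by (simp add: n_subsets card_Diff_subset)
  finally have "card (E - touching A) + (card S choose 2) \<le> (card V - card A choose 2)"
    using disj cS finite_E by (simp add: card_Un_disjoint)
  moreover have "card E = card (E - touching A) + card (touching A)"
  proof -
    have "touching A \<subseteq> E" by (auto simp: touching_def)
    then show ?thesis
      using finite_E by (simp add: card_Diff_subset card_mono finite_subset)
  qed
  ultimately show ?thesis by linarith
qed

section \<open>From small disjoint cliques to triangles of the join\<close>

lemma verts_join: "verts (join_complete (V, E) t) = Inl ` V \<union> Inr ` {..<t}"
  by (auto simp: join_complete_def Let_def)

lemma join_edge_Inl: "{x, y} \<in> E \<Longrightarrow> {Inl x, Inl y} \<in> edges (join_complete (V, E) t)"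
  unfolding join_complete_def Let_def by (force intro: image_eqI[of _ _ "{x, y}"])

lemma join_edge_Inr:
  assumes "i < t" "y \<in> verts (join_complete (V, E) t)" "y \<noteq> Inr i"
  shows "{Inr i, y} \<in> edges (join_complete (V, E) t)"
proof -
  have "{Inr i, y} \<in> {{x, y} | x y. x \<in> Inr ` {..<t} \<and> y \<in> V <+> {..<t} \<and> x \<noteq> y}"
    using assms by (intro CollectI exI[of _ "Inr i"] exI[of _ y]) (auto simp: join_complete_def Let_def)
  then show ?thesis by (simp add: join_complete_def Let_def)
qed

lemma clique_join:
  assumes "clique E C" "C \<subseteq> V" "R \<subseteq> {..<t}"
  shows "clique (edges (join_complete (V, E) t)) (Inl ` C \<union> Inr ` R)"
  unfolding clique_def
proof (intro ballI impI)
  let ?J = "join_complete (V, E) t"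
  fix x y :: "'a + nat"
  assume xy: "x \<in> Inl ` C \<union> Inr ` R" "y \<in> Inl ` C \<union> Inr ` R" "x \<noteq> y"
  then have W: "x \<in> verts ?J" "y \<in> verts ?J" unfolding verts_join using assms by auto
  consider i where "x = Inr i" "i < t" | j where "y = Inr j" "j < t"
    | u v where "x = Inl u" "y = Inl v" "u \<in> C" "v \<in> C"
    using xy assms(3) by blast
  then show "{x, y} \<in> edges ?J"
  proof cases
    case 1
    then show ?thesis using join_edge_Inr[of i t y] W xy by simp
  next
    case 2
    then show ?thesis using join_edge_Inr[of j t x] W xy by (simp add: insert_commute)
  next
    case 3
    then show ?thesis using assms(1) xy join_edge_Inl by (auto simp: clique_def)
  qed
qed

text \<open>New vertices are adjacent to everything, so a clique \<open>C\<close> becomes a triangle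
  once \<open>3 - card C\<close> of them are added. Each clique takes its own block
  \<open>R1\<close> of \<open>R\<close>; the set \<open>R\<close> is arbitrary so that the induction
  can continue with \<open>R - R1\<close>.\<close>

lemma complete_cliques_to_triangles:
  assumes "finite P" "pairwise disjnt P"
    and "\<And>C. C \<in> P \<Longrightarrow> C \<subseteq> V \<and> card C \<le> 3 \<and> clique E C"
    and "R \<subseteq> {..<t}" "(\<Sum>C\<in>P. 3 - card C) \<le> card R"
  shows "\<exists>F. finite F \<and> card F \<le> card P \<and> pairwise disjnt F \<and> Inl ` \<Union>P \<subseteq> \<Union>F
    \<and> \<Union>F \<subseteq> Inl ` \<Union>P \<union> Inr ` R \<and> (\<forall>T\<in>F. triangle (join_complete (V, E) t) T)"
  using assms
proof (induction P arbitrary: R rule: finite_induct)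
  case empty
  then show ?case by (intro exI[of _ "{}"]) auto
next
  case (insert C P)
  have finR: "finite R" using insert.prems(3) finite_subset by blast
  have "3 - card C \<le> card R" using insert by simp
  then obtain R1 where R1: "R1 \<subseteq> R" "card R1 = 3 - card C"
    using obtain_subset_with_card_n by metis
  have "card (R - R1) = card R - card R1"
    using R1(1) finR by (simp add: card_Diff_subset finite_subset)
  then have s: "(\<Sum>C\<in>P. 3 - card C) \<le> card (R - R1)" using insert R1 by simp
  have "\<exists>F. finite F \<and> card F \<le> card P \<and> pairwise disjnt F \<and> Inl ` \<Union>P \<subseteq> \<Union>F
    \<and> \<Union>F \<subseteq> Inl ` \<Union>P \<union> Inr ` (R - R1) \<and> (\<forall>T\<in>F. triangle (join_complete (V, E) t) T)"
  proof (rule insert.IH[OF _ _ _ s])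
    show "pairwise disjnt P" using insert.prems(1) by (simp add: pairwise_insert)
  qed (use insert.prems(2,3) in auto)
  then obtain F where F: "finite F" "card F \<le> card P" "pairwise disjnt F" "Inl ` \<Union>P \<subseteq> \<Union>F"
    "\<Union>F \<subseteq> Inl ` \<Union>P \<union> Inr ` (R - R1)" "\<forall>T\<in>F. triangle (join_complete (V, E) t) T"
    by blast
  define T where "T = (Inl ` C \<union> Inr ` R1 :: ('a + nat) set)"
  have C: "C \<subseteq> V" "card C \<le> 3" "clique E C" using insert.prems(2) by auto
  have "finite C" "finite R1" using C(1) R1(1) finite_V finR finite_subset by blast+
  then have "card T = card C + card R1"
    unfolding T_def by (subst card_Un_disjoint) (auto simp: card_image)
  then have "card T = 3" using R1(2) C(2) by simp
  moreover have "T \<subseteq> verts (join_complete (V, E) t)"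
    unfolding verts_join T_def using C(1) R1(1) insert.prems(3) by auto
  moreover have "clique (edges (join_complete (V, E) t)) T"
    unfolding T_def using C R1(1) insert.prems(3) by (intro clique_join) auto
  ultimately have tri: "triangle (join_complete (V, E) t) T" by (simp add: triangle_iff_clique)
  have "C \<inter> \<Union>P = {}"
    using insert.prems(1) insert.hyps(2) by (force simp: pairwise_insert disjnt_def)
  then have "T \<inter> (Inl ` \<Union>P \<union> Inr ` (R - R1)) = {}" by (auto simp: T_def)
  moreover have "T \<inter> \<Union>F \<subseteq> T \<inter> (Inl ` \<Union>P \<union> Inr ` (R - R1))"
    using F(5) by (rule Int_mono[OF order.refl])
  ultimately have "T \<inter> \<Union>F = {}" by simp
  then have "pairwise disjnt (Set.insert T F)" using F(3) by (rule pairwise_disjnt_insertI[rotated])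
  moreover have "card (Set.insert T F) \<le> card (Set.insert C P)"
    using F(1,2) insert.hyps by (simp add: card_insert_if)
  moreover have "Inl ` \<Union>(Set.insert C P) \<subseteq> \<Union>(Set.insert T F)"
    using F(4) by (auto simp: T_def)
  moreover have "\<Union>(Set.insert T F) \<subseteq> Inl ` \<Union>(Set.insert C P) \<union> Inr ` R"
  proof -
    have "T \<subseteq> Inl ` \<Union>(Set.insert C P) \<union> Inr ` R" using R1(1) by (auto simp: T_def)
    moreover have "\<Union>F \<subseteq> Inl ` \<Union>(Set.insert C P) \<union> Inr ` R"
      by (rule order.trans[OF F(5)]) auto
    ultimately show ?thesis by simp
  qed
  ultimately show ?case using F(1,6) tri by (intro exI[of _ "Set.insert T F"]) simp
qed

text \<open>An uncovered vertex of \<open>A\<close> is taken as a clique of size one, which costs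
  two new vertices. All the cliques are disjoint and meet \<open>A\<close>, so picking a vertex of
  \<open>A\<close> from each is injective and gives \<open>card P <= card A\<close>.\<close>

lemma add_singletons_to_cliques:
  assumes "A \<subseteq> V" "finite P0" "pairwise disjnt P0"
    and P0: "\<And>C. C \<in> P0 \<Longrightarrow> C \<subseteq> V \<and> card C \<le> 3 \<and> clique E C \<and> C \<inter> A \<noteq> {}"
    and sum: "(\<Sum>C\<in>P0. 3 - card C) + 2 * card (A - \<Union>P0) \<le> t"
  shows "\<exists>P. finite P \<and> pairwise disjnt P \<and> card P \<le> card A \<and> A \<subseteq> \<Union>P
    \<and> (\<forall>C\<in>P. C \<subseteq> V \<and> card C \<le> 3 \<and> clique E C) \<and> (\<Sum>C\<in>P. 3 - card C) \<le> t"
proof -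
  let ?S = "(\<lambda>v. {v}) ` (A - \<Union>P0)"
  let ?P = "P0 \<union> ?S"
  have fA: "finite A" using assms(1) finite_V finite_subset by blast
  have fP: "finite ?P" using fA assms(2) by simp
  have dis: "pairwise disjnt ?P"
    using assms(3) unfolding pairwise_def disjnt_def by blast
  have meets: "\<forall>C\<in>?P. \<exists>a. a \<in> C \<and> a \<in> A" using P0 by blast
  then obtain f where f: "\<And>C. C \<in> ?P \<Longrightarrow> f C \<in> C \<and> f C \<in> A" by metis
  have "card ?P \<le> card A"
  proof (rule card_inj_on_le)
    show "inj_on f ?P"
    proof (rule inj_onI)
      fix C D assume "C \<in> ?P" "D \<in> ?P" "f C = f D"
      then have "f C \<in> C \<inter> D" using f by (metis IntI)
      then show "C = D" using dis \<open>C \<in> ?P\<close> \<open>D \<in> ?P\<close> by (metis disjnt_def empty_iff pairwiseD)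
    qed
    show "f ` ?P \<subseteq> A" using f by blast
  qed (fact fA)
  moreover have "(\<Sum>C\<in>?P. 3 - card C) = (\<Sum>C\<in>P0. 3 - card C) + (\<Sum>C\<in>?S. 3 - card C)"
    using fA assms(2) by (intro sum.union_disjoint) auto
  moreover have "(\<Sum>C\<in>?S. 3 - card C) = 2 * card (A - \<Union>P0)"
    by (subst sum.reindex) auto
  moreover have "\<forall>C\<in>?P. C \<subseteq> V \<and> card C \<le> 3 \<and> clique E C"
  proof
    show "C \<subseteq> V \<and> card C \<le> 3 \<and> clique E C" if C: "C \<in> ?P" for C
    proof (cases "C \<in> P0")
      case False
      then obtain v where "C = {v}" "v \<in> A" using C by blast
      then show ?thesis using assms(1) by (auto simp: clique_def)
    qed (use P0 in blast)
  qed
  moreover have "A \<subseteq> \<Union>?P" by auto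
  ultimately show ?thesis using fP dis sum by (intro exI[of _ ?P]) simp
qed

lemma clique_edge:
  assumes "e \<in> E"
  shows "clique E e"
proof -
  obtain x y where "e = {x, y}" using edge[OF assms] by (auto simp: card_2_iff)
  then show ?thesis using assms by (auto simp: clique_def insert_commute)
qed

text \<open>A matching edge costs one new vertex and covers at least one vertex of \<open>A\<close>,
  which alone would cost two. So each edge saves at least one, and the total cost is at most
  \<open>2 * card A - card M\<close>.\<close>

lemma cliques_of_matching:
  assumes "A \<subseteq> V" "M \<subseteq> touching A" "pairwise disjnt M" "2 * card A \<le> t + card M"
  shows "\<exists>P. finite P \<and> pairwise disjnt P \<and> card P \<le> card A \<and> A \<subseteq> \<Union>P
    \<and> (\<forall>C\<in>P. C \<subseteq> V \<and> card C \<le> 3 \<and> clique E C) \<and> (\<Sum>C\<in>P. 3 - card C) \<le> t"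
proof (rule add_singletons_to_cliques)
  show fM: "finite M" using assms(2) finite_touching finite_subset by blast
  have fA: "finite A" using assms(1) finite_V finite_subset by blast
  have M: "e \<in> E" "card e = 2" "e \<inter> A \<noteq> {}" if "e \<in> M" for e
    using assms(2) that edge by (auto simp: touching_def)
  then have "\<forall>e\<in>M. \<exists>a. a \<in> e \<and> a \<in> A" by blast
  then obtain f where f: "\<And>e. e \<in> M \<Longrightarrow> f e \<in> e \<and> f e \<in> A" by metis
  have "card M \<le> card (A \<inter> \<Union>M)"
  proof (rule card_inj_on_le)
    show "inj_on f M"
    proof (rule inj_onI)
      fix C D assume "C \<in> M" "D \<in> M" "f C = f D"
      then have "f C \<in> C \<inter> D" using f by (metis IntI)
      then show "C = D" using assms(3) \<open>C \<in> M\<close> \<open>D \<in> M\<close> by (metis disjnt_def empty_iff pairwiseD)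
    qed
    show "f ` M \<subseteq> A \<inter> \<Union>M" using f by blast
  qed (use fA in simp)
  moreover have "card (A - \<Union>M) = card A - card (A \<inter> \<Union>M)"
    using fA by (simp add: card_Diff_subset_Int)
  moreover have "card (A \<inter> \<Union>M) \<le> card A" using fA by (simp add: card_mono)
  moreover have "(\<Sum>C\<in>M. 3 - card C) = card M" using M(2) by simp
  ultimately show "(\<Sum>C\<in>M. 3 - card C) + 2 * card (A - \<Union>M) \<le> t" using assms(4) by linarith
  show "\<And>C. C \<in> M \<Longrightarrow> C \<subseteq> V \<and> card C \<le> 3 \<and> clique E C \<and> C \<inter> A \<noteq> {}"
    using M edge clique_edge by fastforce
qed (use assms in auto)

end

section \<open>Binomial estimates\<close>

lemma choose_two_add: "(m + r choose 2) = (m choose 2) + (r choose 2) + r * m"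
  by (induction r) (simp_all add: numeral_2_eq_2)

text \<open>The difference of the two binomials counts the pairs meeting a fixed
  \<open>k\<close>-set, and there are at most \<open>k * n\<close> of them. This is what bounds the
  number of non-edges of a graph with many edges.\<close>

lemma choose_two_diff_le:
  assumes "k \<le> n"
  shows "(n choose 2) \<le> (n - k choose 2) + k * n"
proof -
  obtain m where m: "n = m + k" using assms by (metis le_add_diff_inverse2)
  have "(k choose 2) \<le> k * k" unfolding choose_two
    by (rule order.trans[OF div_le_dividend]) simp
  then show ?thesis unfolding m choose_two_add by (simp add: algebra_simps)
qed

section \<open>Covering the vertices of low degree\<close>

context fin_graph
begin

text \<open>The fraction one eighth meets two demands: a vertex above it keeps a large neighbourhood
  after the used vertices are removed, and below it the edges at low vertices are spread out enough
  to contain a large matching.\<close>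

definition low :: "'a set" where
  "low = {v\<in>V. 8 * card (nbrs v) \<le> card V}"

text \<open>At each end \<open>x\<close> of \<open>e\<close> at most \<open>card V div 8\<close>
  edges touch \<open>low\<close>: if \<open>x\<close> is low, by its degree; otherwise the other end
  of such an edge lies in \<open>low\<close>, which is even smaller.\<close>

lemma card_touching_meet_le:
  assumes e: "e \<in> touching low" and small: "50 * card low \<le> card V"
  shows "card {f\<in>touching low. f \<inter> e \<noteq> {}} \<le> 2 * (card V div 8)"
proof -
  have at: "card {f\<in>touching low. x \<in> f} \<le> card V div 8" for x
  proof -
    define S where "S = (if x \<in> low then nbrs x else low)"
    have fS: "finite S" using finite_V by (auto simp: S_def nbrs_def low_def)
    have "{f\<in>touching low. x \<in> f} \<subseteq> (\<lambda>y. {x, y}) ` S"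
    proof
      fix f assume "f \<in> {f\<in>touching low. x \<in> f}"
      then have f: "f \<in> E" "x \<in> f" "f \<inter> low \<noteq> {}" by (auto simp: touching_def)
      obtain y where y: "f = {x, y}" "y \<in> V" using edge_doubleton[OF f(1,2)] by metis
      have "y \<in> S" using f y by (auto simp: S_def nbrs_def)
      then show "f \<in> (\<lambda>y. {x, y}) ` S" using y by blast
    qed
    then have "card {f\<in>touching low. x \<in> f} \<le> card ((\<lambda>y. {x, y}) ` S)"
      using fS by (intro card_mono) auto
    also have "\<dots> \<le> card S" using fS by (rule card_image_le)
    also have "8 * card S \<le> card V" using small by (auto simp: S_def low_def)
    then have "card S \<le> card V div 8" by linarith
    finally show ?thesis .
  qed
  have "e \<in> E" using e by (simp add: touching_def)
  then obtain x y where xy: "e = {x, y}" using edge[of e] by (auto simp: card_2_iff)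
  have "{f\<in>touching low. f \<inter> e \<noteq> {}} = {f\<in>touching low. x \<in> f} \<union> {f\<in>touching low. y \<in> f}"
    unfolding xy by blast
  then show ?thesis using card_Un_le[of "{f\<in>touching low. x \<in> f}" "{f\<in>touching low. y \<in> f}"]
      at[of x] at[of y] by simp
qed

text \<open>With at least \<open>card A + 1\<close> edges at \<open>A\<close>, two of them share their end in \<open>A\<close>; if no two of
  them are disjoint and none lies inside \<open>A\<close>, they form a star, whose leaves are then independent
  unless there is a triangle at its centre.\<close>

lemma cliques_of_touching_edges:
  assumes AV: "A \<subseteq> V" and nonempty: "A \<noteq> {}"
    and many: "card E > (card V - card A choose 2) + card A"
    and t: "2 * card A \<le> t + 2"
  shows "\<exists>P. finite P \<and> pairwise disjnt P \<and> card P \<le> card A \<and> A \<subseteq> \<Union>P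
    \<and> (\<forall>C\<in>P. C \<subseteq> V \<and> card C \<le> 3 \<and> clique E C) \<and> (\<Sum>C\<in>P. 3 - card C) \<le> t"
    (is ?thesis)
proof -
  have fA: "finite A" using AV finite_V finite_subset by blast
  have cT: "card (touching A) > card A"
    using card_E_le[of A "{}"] AV many by simp
  have X: "e \<in> E" "e \<inter> A \<noteq> {}" if "e \<in> touching A" for e
    using that by (auto simp: touching_def)
  \<comment> \<open>Singletons alone may cost up to two new vertices too many. Two disjoint edges at
    \<open>A\<close>, an edge inside \<open>A\<close> or a triangle meeting \<open>A\<close> each
    save at least two, so only the last case is left to refute.\<close>
  consider (disj) e f where "e \<in> touching A" "f \<in> touching A" "e \<inter> f = {}"
    | (inside) e where "e \<in> E" "e \<subseteq> A"
    | (tri) C where "C \<subseteq> V" "card C = 3" "clique E C" "C \<inter> A \<noteq> {}"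
    | (star) "\<And>e f. e \<in> touching A \<Longrightarrow> f \<in> touching A \<Longrightarrow> e \<inter> f \<noteq> {}" "\<And>e. e \<in> E \<Longrightarrow> \<not> e \<subseteq> A"
        "\<And>C. C \<subseteq> V \<Longrightarrow> card C = 3 \<Longrightarrow> clique E C \<Longrightarrow> C \<inter> A = {}"
    by blast
  then show ?thesis
  proof cases
    case disj
    then have "e \<noteq> f" using X by blast
    with disj t show ?thesis
      by (intro cliques_of_matching[of A "{e, f}"] AV) (auto simp: pairwise_insert disjnt_def)
  next
    case inside
    have e2: "card e = 2" using inside edge by blast
    have "card (A - e) = card A - 2" using e2 fA inside by (simp add: card_Diff_subset finite_subset)
    moreover have "e \<inter> A \<noteq> {}" using inside e2 by (auto simp: Int_absorb2)
    ultimately show ?thesis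
      using AV inside e2 t clique_edge[of e] card_mono[OF fA inside(2)]
      by (intro add_singletons_to_cliques[of A "{e}"]) auto
  next
    case tri
    then obtain a where a: "a \<in> C" "a \<in> A" by blast
    have "card (A - C) \<le> card (A - {a})" using a fA by (intro card_mono) auto
    then show ?thesis
      using AV tri t a fA
      by (intro add_singletons_to_cliques[of A "{C}"]) auto
  next
    case star
    have "\<forall>e\<in>touching A. \<exists>a. a \<in> e \<and> a \<in> A" using X by blast
    then obtain g where g: "\<And>e. e \<in> touching A \<Longrightarrow> g e \<in> e \<and> g e \<in> A" by metis
    have "\<not> inj_on g (touching A)"
      using cT card_inj_on_le[of g "touching A" A] g fA by fastforce
    then obtain e1 e2 where e12: "e1 \<in> touching A" "e2 \<in> touching A" "e1 \<noteq> e2" "g e1 = g e2"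
      by (auto simp: inj_on_def)
    define x where "x = g e1"
    have x: "x \<in> e1" "x \<in> e2" "x \<in> A" using g[OF e12(1)] g[OF e12(2)] e12(4) by (simp_all add: x_def)
    obtain u where u: "e1 = {x, u}" using edge_doubleton[OF X(1)[OF e12(1)] x(1)] by metis
    obtain v where v: "e2 = {x, v}" using edge_doubleton[OF X(1)[OF e12(2)] x(2)] by metis
    have uv: "u \<noteq> v" "u \<notin> A" "v \<notin> A"
      using e12(3) star(2)[OF X(1)[OF e12(1)]] star(2)[OF X(1)[OF e12(2)]] x(3) u v by auto
    \<comment> \<open>An edge at \<open>A\<close> avoiding \<open>x\<close> would have to meet both
      \<open>e1\<close> and \<open>e2\<close> in their other ends, hence be \<open>{u, v}\<close>,
      which is disjoint from \<open>A\<close>.\<close>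
    have "touching A \<subseteq> (\<lambda>y. {x, y}) ` nbrs x"
    proof
      fix f assume f: "f \<in> touching A"
      have "x \<in> f"
      proof (rule ccontr)
        assume "x \<notin> f"
        then have "{u, v} \<subseteq> f" using star(1)[OF f e12(1)] star(1)[OF f e12(2)] u v by auto
        moreover have "card f = 2" "finite f" using edge[OF X(1)[OF f]] by (auto intro: card_ge_0_finite)
        ultimately have "f = {u, v}" using uv(1) by (metis card_2_iff card_subset_eq)
        then show False using X(2)[OF f] uv by blast
      qed
      then obtain y where "f = {x, y}" "y \<in> V" using edge_doubleton[OF X(1)[OF f]] by metis
      then show "f \<in> (\<lambda>y. {x, y}) ` nbrs x" using X(1)[OF f] by (auto simp: nbrs_def)
    qed
    moreover have fN: "finite (nbrs x)" using finite_V by (simp add: nbrs_def)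
    ultimately have le: "card (touching A) \<le> card (nbrs x)"
      by (meson card_image_le card_mono finite_imageI le_trans)
    have NA: "nbrs x \<subseteq> V - A" using star(2) x(3) by (auto simp: nbrs_def)
    have ind: "{y, z} \<notin> E" if "y \<in> nbrs x" "z \<in> nbrs x" for y z
    proof
      assume yz: "{y, z} \<in> E"
      then have "y \<noteq> z" using no_loop by blast
      moreover have "x \<noteq> y" "x \<noteq> z" using that no_loop by (auto simp: nbrs_def)
      ultimately have "card {x, y, z} = 3" by simp
      moreover have "clique E {x, y, z}"
        using that yz by (auto simp: clique_def nbrs_def insert_commute)
      moreover have "{x, y, z} \<subseteq> V" using that AV x by (auto simp: nbrs_def)
      ultimately show False using star(3) x(3) by blast
    qed
    have "(\<lambda>y. {x, y}) ` nbrs x \<subseteq> touching A" using x(3) by (auto simp: nbrs_def touching_def)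
    moreover have "inj_on (\<lambda>y. {x, y}) (nbrs x)" by (auto simp: inj_on_def doubleton_eq_iff)
    ultimately have "card (nbrs x) \<le> card (touching A)"
      by (metis card_image card_mono finite_touching)
    then have "card E + (card (nbrs x) choose 2) \<le> card (nbrs x) + (card V - card A choose 2)"
      using card_E_le[OF AV NA ind] le by simp
    then have "(card (nbrs x) choose 2) + card A < card (nbrs x)" using many by linarith
    moreover have "card A > 0" using nonempty fA by (simp add: card_gt_0_iff)
    \<comment> \<open>With \<open>d\<close> the degree of \<open>x\<close>, this is contradictory
      because \<open>d choose 2\<close> is at least \<open>d - 1\<close> for positive
      \<open>d\<close>.\<close>
    ultimately have lt: "(card (nbrs x) choose 2) + 1 < card (nbrs x)" by linarith
    then obtain m where m: "card (nbrs x) = Suc (Suc m)"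
      by (metis One_nat_def Suc_eq_plus1 Suc_lessE less_add_Suc2 less_imp_Suc_add)
    have "m + 1 \<le> (m + 2 choose 2)" using choose_two_add[of "Suc m" 1] by simp
    then show ?thesis using lt m by simp
  qed
qed

text \<open>Covering \<open>low\<close> by singletons costs \<open>2 * card low\<close>, so
  \<open>2 * card low - t\<close> must be saved. Nothing is to be saved when
  \<open>card low < k\<close>; when \<open>card low = k\<close> and \<open>t\<close> is even the
  amount is two, the borderline case treated above; otherwise a matching of
  \<open>2 * card low - t\<close> edges at \<open>low\<close> is found greedily.\<close>

lemma clique_cover_of_low:
  assumes k: "k = t div 2 + 1"
    and many: "card E > (card V - k choose 2) + (if even t then k else 0)"
    and small: "50 * card low \<le> card V"
  shows "\<exists>P. finite P \<and> pairwise disjnt P \<and> card P \<le> card low \<and> low \<subseteq> \<Union>P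
    \<and> (\<forall>C\<in>P. C \<subseteq> V \<and> card C \<le> 3 \<and> clique E C) \<and> (\<Sum>C\<in>P. 3 - card C) \<le> t"
proof -
  have lowV: "low \<subseteq> V" by (auto simp: low_def)
  consider "card low < k" | "card low = k" "even t" | "card low \<ge> k" "odd t \<or> card low > k"
    by linarith
  then show ?thesis
  proof cases
    case 1
    then show ?thesis using k lowV by (intro cliques_of_matching[of low "{}"]) auto
  next
    case 2
    then show ?thesis using k many lowV by (intro cliques_of_touching_edges) auto
  next
    case 3
    define n a r L where "n = card V" and "a = card low" and "r = a - k" and "L = 2 * (n div 8)"
    have a: "a = k + r" "50 * a \<le> n" using 3 small by (auto simp: n_def a_def r_def)
    have "card E \<le> card (touching low) + (n - a choose 2)"
      using card_E_le[of low "{}"] lowV by (simp add: n_def a_def)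
    \<comment> \<open>The pairs between the \<open>r\<close> additional vertices and the remaining
      \<open>n - a\<close> are lost when \<open>k\<close> is replaced by \<open>a\<close>; the edges
      touching \<open>low\<close> must make up for them.\<close>
    moreover have "(n - a choose 2) + r * (n - a) \<le> (n - k choose 2)"
      using choose_two_add[of "n - a" r] a by simp
    ultimately have cT: "card (touching low) > r * (n - a)"
      using many by (auto simp: n_def split: if_splits)
    define s where "s = 2 * a - t - 1"
    have s: "s = (if even t then 2 * r + 1 else 2 * r)" "2 * a = t + Suc s"
      using a k by (auto simp: s_def elim!: evenE oddE)
    \<comment> \<open>For even \<open>t\<close> one has \<open>s = 2 * r + 1\<close>, so this needs
      \<open>r >= 1\<close>; hence the separate case \<open>card low = k\<close>.\<close>
    have "s \<le> 3 * r" using 3 s a by (auto simp: a_def)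
    then have "s * L \<le> 3 * r * L" by (rule mult_right_mono) simp
    also have "\<dots> = r * (3 * L)" by simp
    \<comment> \<open>Here \<open>3 * L\<close> is at most three quarters of \<open>n\<close>, while
      \<open>a\<close> is at most a fiftieth of it.\<close>
    also have "\<dots> \<le> r * (n - a)" using a(2) by (intro mult_left_mono) (auto simp: L_def)
    finally have "s * L < card (touching low)" using cT by linarith
    then have "\<exists>M\<subseteq>touching low. pairwise disjnt M \<and> card M = Suc s"
    proof (rule disjoint_edges_of_bounded_intersections[rotated 3])
      show "card {f \<in> touching low. f \<inter> e \<noteq> {}} \<le> L" if "e \<in> touching low" for e
        using card_touching_meet_le[OF that small] by (simp add: L_def n_def)
    qed (auto simp: finite_touching, auto simp: touching_def)
    then obtain M where M: "M \<subseteq> touching low" "pairwise disjnt M" "card M = Suc s" by blast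
    then show ?thesis using s(2) lowV by (intro cliques_of_matching[of low M]) (auto simp: a_def)
  qed
qed

section \<open>Construction of a triangle factor of the join\<close>

text \<open>The neighbours of \<open>v\<close> outside \<open>U\<close> span more pairs than there
  are non-edges, so some two of them are adjacent and form a triangle with \<open>v\<close>.\<close>

lemma triangle_avoiding:
  assumes v: "v \<in> V" and U: "finite U" "Inl v \<notin> U"
    and many: "card nonedges < (card (nbrs v) - card U choose 2)"
  shows "\<exists>T. Inl v \<in> T \<and> T \<inter> U = {} \<and> triangle (join_complete (V, E) t) T"
proof -
  define S where "S = nbrs v - Inl -` U"
  have fN: "finite (nbrs v)" using finite_V by (simp add: nbrs_def)
  have fU: "finite (Inl -` U)" using U(1) by (simp add: finite_vimageI)
  have "card (Inl -` U) \<le> card U"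
    using card_inj_on_le[of Inl "Inl -` U" U] U(1) by auto
  then have "card (nbrs v) - card U \<le> card S"
    unfolding S_def using diff_card_le_card_Diff[OF fU, of "nbrs v"] by linarith
  then have "card nonedges < card S choose 2"
    using many binomial_right_mono[of _ "card S" 2] by (meson leD le_less_linear le_trans)
  then have "\<not> card E + (card S choose 2) \<le> (card V choose 2)"
    using card_nonedges by linarith
  moreover have "S \<subseteq> V" by (auto simp: S_def nbrs_def)
  moreover have "touching {} = {}" by (simp add: touching_def)
  ultimately have "\<exists>x\<in>S. \<exists>y\<in>S. {x, y} \<in> E"
    using card_E_le[of "{}" S] by (metis Diff_empty add_0 card.empty diff_zero empty_subsetI)
  then obtain x y where xy: "x \<in> S" "y \<in> S" "{x, y} \<in> E" by blast
  have ne: "x \<noteq> y" "x \<noteq> v" "y \<noteq> v" using xy no_loop by (auto simp: S_def nbrs_def)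
  have sub: "{v, x, y} \<subseteq> V" using xy v by (auto simp: S_def nbrs_def)
  have "clique E {v, x, y}" using xy by (auto simp: clique_def S_def nbrs_def insert_commute)
  then have "clique (edges (join_complete (V, E) t)) (Inl ` {v, x, y} \<union> Inr ` {})"
    using sub by (intro clique_join) auto
  moreover have "card (Inl ` {v, x, y}) = 3" using ne by (subst card_image) auto
  moreover have "Inl ` {v, x, y} \<subseteq> verts (join_complete (V, E) t)" using sub by (auto simp: verts_join)
  moreover have "Inl ` {v, x, y} \<inter> U = {}" using xy U(2) by (auto simp: S_def)
  ultimately show ?thesis
    unfolding triangle_iff_clique by (intro exI[of _ "Inl ` {v, x, y}"]) simp
qed

lemma join_has_K3_factor:
  assumes n: "card V \<ge> 2000" and dvd: "3 dvd card V + t" and t: "1000 * t \<le> card V"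
    and k: "k = t div 2 + 1"
    and many: "card E > (card V - k choose 2) + (if even t then k else 0)"
  shows "has_K3_factor (join_complete (V, E) t)"
proof -
  define n where "n = card V"
  define J where "J = join_complete (V, E) t"
  \<comment> \<open>This is where the threshold 2000 is needed: \<open>1000 * k\<close> is at most
    \<open>500 * t + 1000\<close>, hence at most \<open>n / 2 + 1000\<close>.\<close>
  have kn: "1000 * k \<le> n" using k t n by (simp add: n_def)
  have nonE: "card nonedges < k * n"
    using card_nonedges choose_two_diff_le[of k n] many kn by (simp add: n_def)
  \<comment> \<open>The exceptional vertices. Double counting of non-edges gives
    \<open>card B <= 20 * k\<close>, hence at most \<open>n / 50\<close>; outside \<open>B\<close>
    fewer than \<open>n / 10\<close> non-neighbours remain, few enough for the exchange
    argument.\<close>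
  define B where "B = {v\<in>V. n \<le> 10 * card (nonnbrs v)}"
  have fB: "finite B" using finite_V by (simp add: B_def)
  have "card B * n = (\<Sum>v\<in>B. n)" by simp
  also have "\<dots> \<le> (\<Sum>v\<in>B. 10 * card (nonnbrs v))" by (rule sum_mono) (simp add: B_def)
  also have "\<dots> = 10 * (\<Sum>v\<in>B. card (nonnbrs v))" by (simp add: sum_distrib_left)
  also have "\<dots> \<le> 20 * card nonedges" using sum_card_nonnbrs_le[of B] by (simp add: B_def)
  also have "\<dots> \<le> (20 * k) * n" using nonE by simp
  finally have "card B \<le> 20 * k" using n by (simp add: n_def)
  then have cB: "50 * card B \<le> n" using kn by linarith
  have lowB: "low \<subseteq> B"
  proof
    fix v assume "v \<in> low"
    then have v: "v \<in> V" "8 * card (nbrs v) \<le> n" by (auto simp: low_def n_def)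
    have "card (nbrs v) + card (nonnbrs v) + 1 = n" using card_nbrs_nonnbrs[OF v(1)] by (simp add: n_def)
    then have "n \<le> 10 * card (nonnbrs v)" using v(2) n unfolding n_def by linarith
    then show "v \<in> B" using v by (simp add: B_def)
  qed
  have flow: "finite low" using fB lowB finite_subset by blast
  have clow: "card low \<le> card B" using fB lowB by (rule card_mono)
  obtain P where P: "finite P" "pairwise disjnt P" "card P \<le> card low" "low \<subseteq> \<Union>P"
    "\<forall>C\<in>P. C \<subseteq> V \<and> card C \<le> 3 \<and> clique E C" "(\<Sum>C\<in>P. 3 - card C) \<le> t"
    using clique_cover_of_low[OF k many] cB clow unfolding n_def by fastforce
  obtain F0 where F0: "finite F0" "card F0 \<le> card P" "pairwise disjnt F0" "Inl ` \<Union>P \<subseteq> \<Union>F0"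
    "\<forall>T\<in>F0. triangle J T"
    using complete_cliques_to_triangles[of P "{..<t}" t] P unfolding J_def by auto
  have tri3: "card T = 3" "T \<subseteq> verts J" if "triangle J T" for T
    using that by (auto simp: triangle_def)
  let ?S = "Inl ` (B - low) :: ('a + nat) set"
  have cS: "card ?S = card B - card low"
    using lowB flow by (simp add: card_image card_Diff_subset)
  have cFS: "card F0 + card ?S \<le> card B" using cS clow F0(2) P(3) by linarith
  \<comment> \<open>The rest of \<open>B\<close> is covered next. All triangles together number at
    most \<open>card B\<close>, so at most \<open>3 * card B\<close> vertices ever have to be
    avoided.\<close>
  have "\<exists>F. F0 \<subseteq> F \<and> finite F \<and> card F \<le> card F0 + card ?S \<and> pairwise disjnt F
           \<and> (\<forall>T\<in>F. card T = 3 \<and> triangle J T) \<and> ?S \<subseteq> \<Union>F"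
  proof (rule greedy_disjoint_cover)
    fix w :: "'a + nat" and U :: "('a + nat) set"
    assume w: "w \<in> ?S" "finite U" "card U \<le> 3 * (card F0 + card ?S)" "w \<notin> U"
    then obtain v where v: "w = Inl v" "v \<in> B" "v \<notin> low" by blast
    define q where "q = card (nbrs v) - card U"
    have "card U \<le> 3 * card B" using w(3) cFS by simp
    moreover have "n < 8 * card (nbrs v)" using v by (auto simp: low_def B_def n_def)
    \<comment> \<open>The constant is \<open>1/8 - 3/50 = 13/200\<close>.\<close>
    ultimately have q: "13 * n \<le> 200 * q" using cB unfolding q_def by linarith
    have "n * (1000 * 2 * card nonedges) \<le> n * (2 * n * n)"
    proof -
      have "1000 * card nonedges \<le> (1000 * k) * n" using nonE by simp
      also have "\<dots> \<le> n * n" using kn by (rule mult_right_mono) simp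
      finally show ?thesis by simp
    qed
    then have ne: "1000 * (2 * card nonedges) \<le> 2 * (n * n)" using n by (simp add: n_def)
    \<comment> \<open>Lowering \<open>13/200\<close> to \<open>1/20\<close> absorbs the
      \<open>- 1\<close>. Then \<open>q choose 2\<close> is at least \<open>13/8000\<close> times
      \<open>n * n\<close>, above the bound of \<open>1/1000\<close> times \<open>n * n\<close> for
      the non-edges.\<close>
    have "n * 100 \<le> 2000 * (q - 1)" using q n unfolding n_def by linarith
    with q have "(13 * n) * (n * 100) \<le> (200 * q) * (2000 * (q - 1))"
      by (rule mult_mono) simp_all
    then have "13 * (n * n) \<le> 4000 * (q * (q - 1))" by simp
    moreover have "q * (q - 1) = 2 * (q choose 2)"
      unfolding choose_two by (cases q) simp_all
    moreover have "n * n > 0" using n by (simp add: n_def)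
    ultimately have "card nonedges < q choose 2" using ne by linarith
    then show "\<exists>T. w \<in> T \<and> T \<inter> U = {} \<and> card T = 3 \<and> triangle J T"
      using triangle_avoiding[of v U t] v w tri3 unfolding q_def J_def by (auto simp: B_def)
  qed (use fB F0 tri3 in auto)
  then obtain F where F: "F0 \<subseteq> F" "finite F" "card F \<le> card F0 + card ?S" "pairwise disjnt F"
    "\<forall>T\<in>F. card T = 3 \<and> triangle J T" and SF: "?S \<subseteq> \<Union>F"
    by (elim exE conjE) (rule that)
  have F5: "triangle J T" if "T \<in> F" for T using F(5) that by blast
  have cF: "card F \<le> card B" using F(3) cFS by simp
  have BF: "Inl ` B \<subseteq> \<Union>F"
  proof -
    have "Inl ` low \<subseteq> Inl ` \<Union>P" using P(4) by (rule image_mono)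
    also have "\<dots> \<subseteq> \<Union>F0" by (fact F0(4))
    also have "\<dots> \<subseteq> \<Union>F" using F(1) by (rule Union_mono)
    finally have "Inl ` low \<union> ?S \<subseteq> \<Union>F" using SF by (rule Un_least)
    moreover have "Inl ` B \<subseteq> Inl ` low \<union> ?S" by blast
    ultimately show ?thesis by (rule order.trans[rotated])
  qed
  have finJ: "finite (verts J)" using finite_V by (simp add: J_def verts_join)
  have cJ: "card (verts J) = n + t"
    unfolding J_def verts_join using finite_V by (subst card_Un_disjoint) (auto simp: card_image n_def)
  have FJ: "\<Union>F \<subseteq> verts J" using F5 tri3 by blast
  have "card (\<Union>F) = sum card F"
  proof (rule card_Union_disjoint[OF F(4)])
    show "finite T" if "T \<in> F" for T using tri3(2)[OF F5[OF that]] finJ by (rule finite_subset)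
  qed
  then have cUF: "card (\<Union>F) = 3 * card F" using F5 tri3 by simp
  define W where "W = verts J - \<Union>F"
  have cW: "card W + 3 * card F = n + t"
    unfolding W_def using cJ cUF FJ finJ card_mono[OF finJ FJ]
    by (simp add: card_Diff_subset finite_subset)
  obtain P' where P': "\<forall>T\<in>P'. card T = 3 \<and> clique (edges J) T" "pairwise disjnt P'" "\<Union>P' = W"
  proof -
    have "\<exists>P'. (\<forall>T\<in>P'. card T = 3 \<and> clique (edges J) T) \<and> pairwise disjnt P' \<and> \<Union>P' = W"
    proof (rule clique_factor_of_few_nonneighbours)
      show "finite W" using finJ by (simp add: W_def)
      have "3 dvd card W + 3 * card F" using cW dvd by (simp add: n_def)
      then show "3 dvd card W" by (simp add: dvd_add_left_iff)
      \<comment> \<open>At most \<open>3 * card B\<close>, so at most \<open>3/50\<close> of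
        \<open>n\<close>, has been removed; the remainder well exceeds half of
        \<open>n\<close>.\<close>
      show "5 * (n div 10) + 3 < card W" using cW cF cB n unfolding n_def by linarith
      fix w assume w: "w \<in> W"
      show "card {y\<in>W. y \<noteq> w \<and> {w, y} \<notin> edges J} \<le> n div 10"
      proof (cases w)
        case (Inr i)
        then have "{y\<in>W. y \<noteq> w \<and> {w, y} \<notin> edges J} = {}"
          using w join_edge_Inr[of i t] by (auto simp: W_def J_def verts_join)
        then show ?thesis by (simp only: card.empty le0)
      next
        case (Inl x)
        have x: "x \<in> V" "x \<notin> B" using w BF Inl by (auto simp: W_def J_def verts_join)
        have "{y\<in>W. y \<noteq> w \<and> {w, y} \<notin> edges J} \<subseteq> Inl ` nonnbrs x"
        proof
          fix y assume y: "y \<in> {y\<in>W. y \<noteq> w \<and> {w, y} \<notin> edges J}"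
          show "y \<in> Inl ` nonnbrs x"
          proof (cases y)
            case (Inl z)
            then show ?thesis using y \<open>w = Inl x\<close> join_edge_Inl[of x z t]
              by (auto simp: nonnbrs_def W_def J_def verts_join)
          next
            case (Inr i)
            then show ?thesis using y w join_edge_Inr[of i t w]
              by (auto simp: W_def J_def verts_join insert_commute)
          qed
        qed
        then have "card {y\<in>W. y \<noteq> w \<and> {w, y} \<notin> edges J} \<le> card (nonnbrs x)"
          using finite_V by (intro surj_card_le) (simp_all add: nonnbrs_def)
        moreover have "10 * card (nonnbrs x) < n" using x by (auto simp: B_def)
        ultimately show ?thesis by linarith
      qed
    qed
    then show ?thesis using that by blast
  qed
  have "pairwise disjnt (F \<union> P')"
  proof -
    have "disjnt S T" "disjnt T S" if "S \<in> F" "T \<in> P'" for S T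
      using that P'(3) unfolding W_def disjnt_def by blast+
    then show ?thesis using F(4) P'(2) unfolding pairwise_def by blast
  qed
  moreover have "\<Union>(F \<union> P') = verts J" using P'(3) FJ by (auto simp: W_def)
  moreover have "triangle J T" if "T \<in> F \<union> P'" for T
    using that F5 P' by (auto simp: triangle_iff_clique W_def)
  ultimately have "\<exists>F. (\<forall>T\<in>F. triangle J T) \<and> pairwise disjnt F \<and> \<Union>F = verts J"
    by (intro exI[of _ "F \<union> P'"]) simp
  then show ?thesis by (simp only: has_K3_factor_def J_def)
qed

end

section \<open>Sharpness\<close>

lemma join_edge_InlD: "{Inl x, Inl y} \<in> edges (join_complete G t) \<Longrightarrow> {x, y} \<in> edges G"
proof -
  assume "{Inl x, Inl y} \<in> edges (join_complete G t)"
  then have "{Inl x, Inl y} \<in> (\<lambda>e. Inl ` e) ` edges G \<union>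
      {{u, v} | u v. u \<in> Inr ` {..<t} \<and> v \<in> verts G <+> {..<t} \<and> u \<noteq> v}" (is "_ \<in> ?X \<union> ?Y")
    by (simp only: join_complete_def Let_def snd_conv)
  moreover have "{Inl x, Inl y} \<notin> ?Y" by (auto simp: doubleton_eq_iff)
  ultimately have "{Inl x, Inl y} \<in> ?X" by blast
  then obtain e where e: "e \<in> edges G" "Inl ` e = {Inl x, Inl y :: 'a + nat}" by auto
  then have "Inl ` e = (Inl ` {x, y} :: ('a + nat) set)" by simp
  then have "e = {x, y}" by (simp only: inj_image_eq_iff[OF inj_Inl])
  then show ?thesis using e(1) by simp
qed

text \<open>The triangle covering a vertex of \<open>A\<close> takes its other two vertices from
  \<open>N\<close> or the new vertices. Since \<open>A\<close> and \<open>N\<close> are disjoint, no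
  triangle covers two vertices of \<open>A\<close>, so a factor would use \<open>2 * card A\<close>
  distinct vertices of a set with at most \<open>card N + t\<close>.\<close>

lemma no_K3_factor_if_sparse_set:
  assumes A: "A \<subseteq> verts G" "finite A" and fin: "finite N" and AN: "A \<inter> N = {}"
    and nbr: "\<And>a y. a \<in> A \<Longrightarrow> {a, y} \<in> edges G \<Longrightarrow> y \<in> N"
    and few: "card N + t < 2 * card A"
  shows "\<not> has_K3_factor (join_complete G t)"
proof
  let ?J = "join_complete G t"
  assume "has_K3_factor ?J"
  then obtain F where F: "\<And>T. T \<in> F \<Longrightarrow> triangle ?J T" "pairwise disjnt F" "\<Union>F = verts ?J"
    by (auto simp: has_K3_factor_def)
  have vJ: "verts ?J = Inl ` verts G \<union> Inr ` {..<t}" by (auto simp: join_complete_def Let_def)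
  have "\<forall>a\<in>A. \<exists>T\<in>F. Inl a \<in> T"
  proof
    fix a assume "a \<in> A"
    then have "Inl a \<in> \<Union>F" unfolding F(3) vJ using A by blast
    then show "\<exists>T\<in>F. Inl a \<in> T" by blast
  qed
  then obtain tr where tr: "\<And>a. a \<in> A \<Longrightarrow> tr a \<in> F \<and> Inl a \<in> tr a" by metis
  define Q :: "('a + nat) set" where "Q = Inl ` N \<union> Inr ` {..<t}"
  have fQ: "finite Q" using fin by (simp add: Q_def)
  have sub: "tr a - {Inl a} \<subseteq> Q" if a: "a \<in> A" for a
  proof
    fix y assume y: "y \<in> tr a - {Inl a}"
    have T: "triangle ?J (tr a)" using F(1) tr a by blast
    then have e: "{Inl a, y} \<in> edges ?J" using y tr[OF a] by (auto simp: triangle_def)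
    have yJ: "y \<in> verts ?J" using T y by (auto simp: triangle_def)
    show "y \<in> Q"
    proof (cases y)
      case (Inl z)
      then have "z \<in> N" using e nbr[OF a] join_edge_InlD[of a z G t] by simp
      then show ?thesis using Inl by (simp add: Q_def)
    next
      case (Inr i)
      then show ?thesis using yJ unfolding vJ Q_def by blast
    qed
  qed
  have "card (tr a - {Inl a}) = 2" if "a \<in> A" for a
    using F(1) tr that by (simp add: triangle_def)
  then have "2 * card A = (\<Sum>a\<in>A. card (tr a - {Inl a}))" by simp
  also have "\<dots> = card (\<Union>a\<in>A. tr a - {Inl a})"
  proof (rule card_UN_disjoint[symmetric, OF A(2)])
    show "\<forall>a\<in>A. finite (tr a - {Inl a})"
    proof
      show "finite (tr a - {Inl a})" if "a \<in> A" for a using sub[OF that] fQ by (rule finite_subset)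
    qed
    have "(tr a - {Inl a}) \<inter> (tr b - {Inl b}) = {}" if ab: "a \<in> A" "b \<in> A" "a \<noteq> b" for a b
    proof (cases "tr a = tr b")
      case True
      then have "Inl b \<in> tr a - {Inl a}" using tr[OF ab(2)] ab(3) by auto
      then have "Inl b \<in> Q" using sub[OF ab(1)] by blast
      then show ?thesis using ab(2) AN by (auto simp: Q_def)
    next
      case False
      then have "disjnt (tr a) (tr b)" using F(2) tr ab by (meson pairwiseD)
      then show ?thesis by (auto simp: disjnt_def)
    qed
    then show "\<forall>i\<in>A. \<forall>j\<in>A. i \<noteq> j \<longrightarrow> (tr i - {Inl i}) \<inter> (tr j - {Inl j}) = {}" by blast
  qed
  also have "\<dots> \<le> card Q"
    using sub fQ by (intro card_mono UN_least)
  also have "\<dots> \<le> card N + t"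
    unfolding Q_def using fin by (subst card_Un_disjoint) (auto simp: card_image)
  finally show False using few by simp
qed

text \<open>The vertices from \<open>k\<close> on form a clique; those below \<open>k\<close> are
  isolated for odd \<open>t\<close> and joined only to the vertex \<open>k\<close> for even
  \<open>t\<close>. They need \<open>2 * k\<close> further vertices, which is \<open>t + 1\<close>
  against \<open>t\<close> available for odd \<open>t\<close>, and \<open>t + 2\<close> against
  \<open>t + 1\<close> for even \<open>t\<close>.\<close>

lemma sharp_example:
  assumes k: "k = t div 2 + 1" "k < n"
  shows "\<exists>G :: nat ugraph. simple_graph G \<and> card (verts G) = n
    \<and> \<not> has_K3_factor (join_complete G t)
    \<and> num_edges G = (n - k choose 2) + (if even t then k else 0)"
proof -
  define E1 E2 where "E1 = {e. e \<subseteq> {k..<n} \<and> card e = 2}"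
    and "E2 = (if even t then (\<lambda>i. {i, k}) ` {..<k} else {})"
  define N where "N = (if even t then {k} else {})"
  let ?G = "({..<n}, E1 \<union> E2)"
  have "simple_graph ?G" using k(2) by (auto simp: simple_graph_def E1_def E2_def)
  moreover have "num_edges ?G = (n - k choose 2) + (if even t then k else 0)"
  proof -
    have "card E1 = (n - k choose 2)" by (simp add: E1_def n_subsets)
    moreover have "card E2 = (if even t then k else 0)"
    proof -
      have "inj_on (\<lambda>i. {i, k}) {..<k}" by (rule inj_onI) (simp add: doubleton_eq_iff)
      then show ?thesis by (simp add: E2_def card_image)
    qed
    moreover have "E1 \<inter> E2 = {}"
    proof -
      have "e \<subseteq> {k..<n}" if "e \<in> E1" for e using that by (simp add: E1_def)
      moreover have "\<not> e \<subseteq> {k..<n}" if "e \<in> E2" for e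
      proof -
        have "e \<in> (\<lambda>i. {i, k}) ` {..<k}" using that by (simp add: E2_def split: if_splits)
        then obtain i where "e = {i, k}" "i < k" by blast
        then show ?thesis by simp
      qed
      ultimately show ?thesis by blast
    qed
    moreover have "finite E1" by (simp add: E1_def)
    moreover have "finite E2" by (simp add: E2_def)
    ultimately show ?thesis by (simp add: num_edges_def card_Un_disjoint)
  qed
  moreover have "\<not> has_K3_factor (join_complete ?G t)"
  proof (rule no_K3_factor_if_sparse_set)
    show "y \<in> N" if "a \<in> {..<k}" "{a, y} \<in> edges ?G" for a y
      using that by (auto simp: E1_def E2_def N_def doubleton_eq_iff split: if_splits)
    show "card N + t < 2 * card {..<k}" using k(1) by (auto simp: N_def elim: oddE)
  qed (use k in \<open>auto simp: N_def\<close>)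
  ultimately show ?thesis by (intro exI[of _ ?G]) simp
qed

section \<open>The stated bound in binomial form, and both directions\<close>

theorem theorem2p2:
  "\<exists>n0::nat. \<forall>n t :: nat.
     n \<ge> n0 \<and> 3 dvd n + t \<and> real t \<le> real n / 1000 \<longrightarrow>
     (let k = nat \<lceil>(real t + 1) / 2\<rceil>;
          bound = int (n choose 2) - int (k choose 2)
                    - (if odd t then int k * (int n - int k)
                       else int k * (int n - int k - 1))
      in (\<forall>G :: 'a ugraph.
            simple_graph G \<and> card (verts G) = n \<and> \<not> has_K3_factor (join_complete G t)
              \<longrightarrow> int (num_edges G) \<le> bound)
       \<and> (\<exists>G :: nat ugraph.
            simple_graph G \<and> card (verts G) = n \<and> \<not> has_K3_factor (join_complete G t)
              \<and> int (num_edges G) = bound))"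
proof (intro exI[of _ 2000] allI impI, elim conjE)
  fix n t :: nat
  assume n: "2000 \<le> n" and dvd: "3 dvd n + t" and "real t \<le> real n / 1000"
  then have t: "1000 * t \<le> n" by simp
  define k where "k = t div 2 + 1"
  have kn: "k < n" using t n by (simp add: k_def)
  \<comment> \<open>The parity split evaluates the ceiling: it is \<open>t div 2 + 1\<close> for
    even and odd \<open>t\<close> alike.\<close>
  have "t = 2 * (t div 2) \<or> t = 2 * (t div 2) + 1" by linarith
  then have "real t = 2 * real (t div 2) \<or> real t = 2 * real (t div 2) + 1" by linarith
  then have "\<lceil>(real t + 1) / 2\<rceil> = int k"
    by (intro ceiling_unique) (auto simp: k_def)
  then have k: "nat \<lceil>(real t + 1) / 2\<rceil> = k" by simp
  \<comment> \<open>Removing all pairs that meet a \<open>k\<close>-set from the pairs of an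
    \<open>n\<close>-set leaves \<open>n - k choose 2\<close>; for even \<open>t\<close> the factor
    \<open>n - k - 1\<close> gives back \<open>k\<close> of them.\<close>
  define b where "b = (n - k choose 2) + (if even t then k else 0)"
  have "(n choose 2) = (n - k choose 2) + (k choose 2) + k * (n - k)"
    using choose_two_add[of "n - k" k] kn by simp
  then have "int (n choose 2) = int (n - k choose 2) + int (k choose 2) + int k * (int n - int k)"
    using kn by (simp only: of_nat_add of_nat_mult of_nat_diff less_imp_le)
  then have b: "int (n choose 2) - int (k choose 2)
      - (if odd t then int k * (int n - int k) else int k * (int n - int k - 1)) = int b"
    by (simp add: b_def algebra_simps)
  have upper: "num_edges G \<le> b"
    if G: "simple_graph G" "card (verts G) = n" "\<not> has_K3_factor (join_complete G t)" for G :: "'a ugraph"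
  proof (rule ccontr)
    assume less: "\<not> num_edges G \<le> b"
    have "fin_graph (verts G) (edges G)"
      using G(1) by unfold_locales (auto simp: simple_graph_def)
    then have "has_K3_factor (join_complete (verts G, edges G) t)"
      using fin_graph.join_has_K3_factor[of "verts G" "edges G" t k] n dvd t G(2) less by (simp add: k_def b_def num_edges_def)
    then show False using G(3) by simp
  qed
  have lower: "\<exists>G :: nat ugraph. simple_graph G \<and> card (verts G) = n
      \<and> \<not> has_K3_factor (join_complete G t) \<and> num_edges G = b"
    unfolding b_def by (rule sharp_example[OF k_def kn])
  show "let k = nat \<lceil>(real t + 1) / 2\<rceil>;
          bound = int (n choose 2) - int (k choose 2)
                    - (if odd t then int k * (int n - int k)
                       else int k * (int n - int k - 1))
      in (\<forall>G :: 'a ugraph.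
            simple_graph G \<and> card (verts G) = n \<and> \<not> has_K3_factor (join_complete G t)
              \<longrightarrow> int (num_edges G) \<le> bound)
       \<and> (\<exists>G :: nat ugraph.
            simple_graph G \<and> card (verts G) = n \<and> \<not> has_K3_factor (join_complete G t)
              \<and> int (num_edges G) = bound)"
    unfolding Let_def k b of_nat_le_iff of_nat_eq_iff using upper lower by blast
qed

end
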